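(* Consider a pair of aircraft $(i,j)$ with relative velocity box $\mathcal{B}_{ij}\subset\mathbb{R}^2$ and conflict region $\mathcal{C}_{ij}\subset\mathbb{R}^2$. The pair $(i,j)$ is non-separable (that is, $\mathcal{B}_{ij}\subseteq\mathcal{C}_{ij}$) if and only if each of the four extreme points of $\mathcal{B}_{ij}$ corresponds to a conflict (that is, belongs to $\mathcal{C}_{ij}$).
   Context: Let $d>0$ be the minimum separation distance and $(\hat x_{ij},\hat y_{ij})$ the initial relative position of aircraft $i$ and $j$, assumed initially separated: $\hat x_{ij}^2+\hat y_{ij}^2\ge d^2$. Relative velocity box: $\mathcal{B}_{ij}=\{(v_x,v_y)\in\mathbb{R}^2:\underline v_{ij,x}\le v_x\le\overline v_{ij,x},\ \underline v_{ij,y}\le v_y\le\overline v_{ij,y}\}$, where $\underline v_{ij,x}\le\overline v_{ij,x}$ and $\underline v_{ij,y}\le\overline v_{ij,y}$ are real lower and upper bounds on the components of the relative velocity of $i$ with respect to $j$, derived from bounds on the aircraft speed and heading controls. Its four extreme points are the corners $(a,b)$ with $a\in\{\underline v_{ij,x},\overline v_{ij,x}\}$, $b\in\{\underline v_{ij,y},\overline v_{ij,y}\}$. Conflict region: $\mathcal{C}_{ij}=\{(v_x,v_y)\in\mathbb{R}^2: v_y\gamma_{ij}^l-v_x\phi_{ij}^l\ge 0\ \text{and}\ v_y\gamma_{ij}^u-v_x\phi_{ij}^u\le 0\}$, taken to be the set of relative velocities corresponding to a conflict. Here, with $s=\sqrt{\hat x_{ij}^2+\hat y_{ij}^2-d^2}$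 and up to positive scaling, $(\gamma_{ij}^l,\phi_{ij}^l)=(\hat x_{ij}s-\hat y_{ij}d,\hat y_{ij}s+\hat x_{ij}d)$ and $(\gamma_{ij}^u,\phi_{ij}^u)=(\hat x_{ij}s+\hat y_{ij}d,\hat y_{ij}s-\hat x_{ij}d)$. A pair $(i,j)$ is called non-separable if $\mathcal{B}_{ij}\subseteq\mathcal{C}_{ij}$. *)

theory Defs
  imports "HOL-Analysis.Analysis"
begin

text \<open>
  For one pair of aircraft: \<open>d\<close> is the separation distance, \<open>(x, y)\<close> the initial relative
  position, and \<open>lx, ux, ly, uy\<close> the lower and upper bounds on the two components of the
  relative velocity.
\<close>

definition velocity_box :: "real \<Rightarrow> real \<Rightarrow> real \<Rightarrow> real \<Rightarrow> (real \<times> real) set" where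
  "velocity_box lx ux ly uy = {(vx, vy). lx \<le> vx \<and> vx \<le> ux \<and> ly \<le> vy \<and> vy \<le> uy}"

definition sep_root :: "real \<Rightarrow> real \<Rightarrow> real \<Rightarrow> real" where
  "sep_root d x y = sqrt (x\<^sup>2 + y\<^sup>2 - d\<^sup>2)"

definition gamma_l :: "real \<Rightarrow> real \<Rightarrow> real \<Rightarrow> real" where
  "gamma_l d x y = x * sep_root d x y - y * d"

definition phi_l :: "real \<Rightarrow> real \<Rightarrow> real \<Rightarrow> real" where
  "phi_l d x y = y * sep_root d x y + x * d"

definition gamma_u :: "real \<Rightarrow> real \<Rightarrow> real \<Rightarrow> real" where
  "gamma_u d x y = x * sep_root d x y + y * d"

definition phi_u :: "real \<Rightarrow> real \<Rightarrow> real \<Rightarrow> real" where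
  "phi_u d x y = y * sep_root d x y - x * d"

definition conflict_region :: "real \<Rightarrow> real \<Rightarrow> real \<Rightarrow> (real \<times> real) set" where
  "conflict_region d x y =
     {(vx, vy). vy * gamma_l d x y - vx * phi_l d x y \<ge> 0 \<and>
                vy * gamma_u d x y - vx * phi_u d x y \<le> 0}"

definition non_separable ::
  "real \<Rightarrow> real \<Rightarrow> real \<Rightarrow> real \<Rightarrow> real \<Rightarrow> real \<Rightarrow> real \<Rightarrow> bool" where
  "non_separable d x y lx ux ly uy \<longleftrightarrow> velocity_box lx ux ly uy \<subseteq> conflict_region d x y"

text \<open>
  The coefficients are meaningful only up to positive scaling; fixing one representative
  above loses nothing.
\<close>

lemma conflict_region_scaled:
  assumes "k > 0" "m > 0"
  shows "conflict_region d x y =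
     {(vx, vy). vy * (k * gamma_l d x y) - vx * (k * phi_l d x y) \<ge> 0 \<and>
                vy * (m * gamma_u d x y) - vx * (m * phi_u d x y) \<le> 0}"
proof -
  have k: "vy * (k * g) - vx * (k * p) = k * (vy * g - vx * p)" for vx vy g p
    by (simp add: algebra_simps)
  have m: "vy * (m * g) - vx * (m * p) = m * (vy * g - vx * p)" for vx vy g p
    by (simp add: algebra_simps)
  show ?thesis
    unfolding conflict_region_def k m
    using assms by (simp add: zero_le_mult_iff mult_le_0_iff)
qed

text \<open>
  The extreme points of the box are its corners. These coincide in part when the box is
  degenerate.
\<close>

lemma extreme_point_of_Times_iff:
  fixes S :: "'a::real_vector set" and T :: "'b::real_vector set"
  shows "(a, b) extreme_point_of (S \<times> T) \<longleftrightarrow> a extreme_point_of S \<and> b extreme_point_of T"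
proof (intro iffI)
  assume L: "(a, b) extreme_point_of (S \<times> T)"
  then have ab: "a \<in> S" "b \<in> T"
    by (auto simp: extreme_point_of_def)
  have "a \<notin> open_segment p q" if "p \<in> S" "q \<in> S" for p q
  proof
    assume "a \<in> open_segment p q"
    then have "(a, b) \<in> open_segment (p, b) (q, b)"
      by (auto simp: in_segment algebra_simps)
    with L that ab show False
      by (auto simp: extreme_point_of_def)
  qed
  moreover have "b \<notin> open_segment p q" if "p \<in> T" "q \<in> T" for p q
  proof
    assume "b \<in> open_segment p q"
    then have "(a, b) \<in> open_segment (a, p) (a, q)"
      by (auto simp: in_segment algebra_simps)
    with L that ab show False
      by (auto simp: extreme_point_of_def)
  qed
  ultimately show "a extreme_point_of S \<and> b extreme_point_of T"
    using ab by (auto simp: extreme_point_of_def)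
next
  assume R: "a extreme_point_of S \<and> b extreme_point_of T"
  then show "(a, b) extreme_point_of (S \<times> T)"
    unfolding extreme_point_of_def
    by (auto dest: open_segment_PairD) (metis empty_iff open_segment_PairD open_segment_idem)
qed

lemma extreme_points_velocity_box:
  assumes "lx \<le> ux" "ly \<le> uy"
  shows "{v. v extreme_point_of velocity_box lx ux ly uy} = {lx, ux} \<times> {ly, uy}"
proof -
  have "velocity_box lx ux ly uy = closed_segment lx ux \<times> closed_segment ly uy"
    using assms by (auto simp: velocity_box_def closed_segment_eq_real_ivl)
  then show ?thesis
    by (auto simp: extreme_point_of_Times_iff extreme_point_of_segment)
qed

end

theory Submission
  imports Defs
begin

text \<open>
  The conflict region is a convex cone, being the intersection of two half-planes whose
  boundaries pass through the origin, and the velocity box is compact and convex. By the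
  Krein--Milman--Minkowski theorem the box is the convex hull of its extreme points, so a
  convex set contains the box as soon as it contains these points. This works uniformly for
  degenerate boxes, where some of the corners coincide.
\<close>

lemma compact_convex_subset_iff_extreme_points:
  fixes S C :: "'a::euclidean_space set"
  assumes "compact S" "convex S" "convex C"
  shows "S \<subseteq> C \<longleftrightarrow> (\<forall>v. v extreme_point_of S \<longrightarrow> v \<in> C)"
proof
  assume "S \<subseteq> C"
  then show "\<forall>v. v extreme_point_of S \<longrightarrow> v \<in> C"
    by (auto simp: extreme_point_of_def)
next
  assume "\<forall>v. v extreme_point_of S \<longrightarrow> v \<in> C"
  then have "convex hull {v. v extreme_point_of S} \<subseteq> C"
    using \<open>convex C\<close> by (intro hull_minimal) auto
  then show "S \<subseteq> C"
    using Krein_Milman_Minkowski[OF \<open>compact S\<close> \<open>convex S\<close>] by simp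
qed

lemma velocity_box_eq_cbox: "velocity_box lx ux ly uy = cbox (lx, ly) (ux, uy)"
  by (auto simp: velocity_box_def cbox_Pair_eq)

lemma convex_conflict_region: "convex (conflict_region d x y)"
proof -
  have "conflict_region d x y =
      {v. inner (- phi_l d x y, gamma_l d x y) v \<ge> 0} \<inter>
      {v. inner (- phi_u d x y, gamma_u d x y) v \<le> 0}"
    by (auto simp: conflict_region_def inner_Pair algebra_simps)
  then show ?thesis
    by (simp only: convex_Int convex_halfspace_ge convex_halfspace_le)
qed

theorem proposition2:
  fixes d x y lx ux ly uy :: real
  assumes "d > 0"
    and "x\<^sup>2 + y\<^sup>2 \<ge> d\<^sup>2"
    and "lx \<le> ux" and "ly \<le> uy"
  shows "non_separable d x y lx ux ly uy \<longleftrightarrow>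
         (\<forall>v. v extreme_point_of velocity_box lx ux ly uy \<longrightarrow> v \<in> conflict_region d x y)"
  unfolding non_separable_def velocity_box_eq_cbox
  by (intro compact_convex_subset_iff_extreme_points compact_cbox convex_box(1)
      convex_conflict_region)

end
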